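(* For all $n\ge 1$ and $k\in[n]$, the map $\rho$ is a bijection from $\mathcal{DU}_{n,k}$ onto $\mathcal{MM}'_{n,k}$.
   Context: $[n]=\{1,\dots,n\}$. $\mathcal{DU}_{n,k}$ is the set of permutations $\pi$ of $[n]$ with $\pi_1>\pi_2<\pi_3>\cdots$ and $\pi_1=k$. A permutation is alternating if $\pi_1>\pi_2<\pi_3>\cdots$ or $\pi_1<\pi_2>\pi_3<\cdots$; $\mathcal{MM}_n$ is the set of alternating permutations of $[n]$ in which $1$ occurs before $n$. For $k\le n-1$, $\mathcal{MM}'_{n,k}$ is the set of $\pi\in\mathcal{MM}_n$ in which the letter immediately before $1$ is $k$; $\mathcal{MM}'_{n,n}$ is the set of $\pi\in\mathcal{MM}_n$ with $\pi_1=1$. For a word $w=w_1\cdots w_m$, $w^R=w_m\cdots w_1$. For a finite ordered set $J=\{b_1<\dots<b_r\}$, let $\sigma_J$ be the order-reversing bijection $b_i\mapsto b_{r+1-i}$ of $J$. The map $\rho$ on $\mathcal{DU}_{n,k}$: if $k=n$, $\rho(\pi)=\overline{\pi}$ where $\overline{\pi}_i=n+1-\pi_i$. If $k\le n-1$ and $1$ occurs before $n$ in $\pi$, write $\pi=\sigma_1\,1\,\sigma_2$ and set $\rho(\pi)=\sigma_1^R\,1\,\sigma_2$. If $k\le n-1$ and $n$ occurs before $1$, write $\pi=\sigma_1\,n\,\sigma_2$, let $J$ be the set of letters of $\sigma_2$ together with $n$, let $\tau$ be the word obtained from $\sigma_2$ by applying $\sigma_J$ to each letter, and set $\rho(\pi)=\sigma_1^R\,1\,\tau$.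 *)

theory Defs
  imports "HOL-Combinatorics.Multiset_Permutations"
begin

text \<open>
  Permutations of \<open>{1..n}\<close> are words (lists) in \<open>permutations_of_set {1..n}\<close>.
  List positions start at 0, so the position \<open>i\<close> of the usual one-line notation is list index
  \<open>i - 1\<close>.
\<close>

definition down_up :: "nat list \<Rightarrow> bool" where
  "down_up w \<longleftrightarrow>
    (\<forall>i < length w - 1. if even i then w ! i > w ! (i + 1) else w ! i < w ! (i + 1))"

definition up_down :: "nat list \<Rightarrow> bool" where
  "up_down w \<longleftrightarrow>
    (\<forall>i < length w - 1. if even i then w ! i < w ! (i + 1) else w ! i > w ! (i + 1))"

definition alternating :: "nat list \<Rightarrow> bool" where
  "alternating w \<longleftrightarrow> down_up w \<or> up_down w"

definition occurs_before :: "'a \<Rightarrow> 'a \<Rightarrow> 'a list \<Rightarrow> bool" where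
  "occurs_before a b w \<longleftrightarrow> (\<exists>j < length w. \<exists>i < j. w ! i = a \<and> w ! j = b)"

definition immediately_before :: "'a \<Rightarrow> 'a \<Rightarrow> 'a list \<Rightarrow> bool" where
  "immediately_before a b w \<longleftrightarrow> (\<exists>i < length w - 1. w ! i = a \<and> w ! (i + 1) = b)"

definition DU :: "nat \<Rightarrow> nat \<Rightarrow> nat list set" where
  "DU n k = {p \<in> permutations_of_set {1..n}. down_up p \<and> hd p = k}"

text \<open>
  For \<open>n = 1\<close> the letters \<open>1\<close> and \<open>n\<close> coincide; the condition that \<open>1\<close> occurs before \<open>n\<close>
  is then taken to hold, so that \<open>MM 1 = {[1]}\<close>.
\<close>

definition MM :: "nat \<Rightarrow> nat list set" where
  "MM n = {p \<in> permutations_of_set {1..n}. alternating p \<and> (n = 1 \<or> occurs_before 1 n p)}"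

definition MM' :: "nat \<Rightarrow> nat \<Rightarrow> nat list set" where
  "MM' n k =
    (if k = n then {p \<in> MM n. hd p = 1} else {p \<in> MM n. immediately_before k 1 p})"

text \<open>
  With \<open>J = {b\<^sub>1 < \<dots> < b\<^sub>r}\<close>, the association list below pairs each
  \<open>b\<^sub>i\<close> with the \<open>i\<close>-th entry from the end of the increasing enumeration.
\<close>

definition order_reversal :: "nat set \<Rightarrow> nat \<Rightarrow> nat" where
  "order_reversal J b =
    the (map_of (zip (sorted_list_of_set J) (rev (sorted_list_of_set J))) b)"

lemma order_reversal_nth:
  assumes "finite J" "i < card J"
  shows "order_reversal J (sorted_list_of_set J ! i) = sorted_list_of_set J ! (card J - 1 - i)"
proof -
  let ?bs = "sorted_list_of_set J"
  have "map_of (zip ?bs (rev ?bs)) (?bs ! i) = Some (rev ?bs ! i)"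
    using assms by (intro map_of_zip_nth) auto
  then show ?thesis
    using assms by (simp add: order_reversal_def rev_nth)
qed

definition before_letter :: "'a \<Rightarrow> 'a list \<Rightarrow> 'a list" where
  "before_letter a w = takeWhile (\<lambda>x. x \<noteq> a) w"

definition after_letter :: "'a \<Rightarrow> 'a list \<Rightarrow> 'a list" where
  "after_letter a w = tl (dropWhile (\<lambda>x. x \<noteq> a) w)"

lemma split_at_letter:
  assumes "a \<in> set w"
  shows "w = before_letter a w @ a # after_letter a w"
  using assms by (induction w) (auto simp: before_letter_def after_letter_def)

text \<open>
  For \<open>k < n\<close> a permutation of \<open>{1..n}\<close> has \<open>1 \<noteq> n\<close>, so the last branch is exactly the case in
  which \<open>n\<close> occurs before \<open>1\<close>.
\<close>

definition rho :: "nat \<Rightarrow> nat \<Rightarrow> nat list \<Rightarrow> nat list" where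
  "rho n k p =
    (if k = n then map (\<lambda>x. n + 1 - x) p
     else if occurs_before 1 n p then
       rev (before_letter 1 p) @ 1 # after_letter 1 p
     else
       (let s1 = before_letter n p; s2 = after_letter n p; J = insert n (set s2)
        in rev s1 @ 1 # map (order_reversal J) s2))"

end

theory Submission imports Defs begin

text \<open>
  For \<open>k < n\<close>, write a word of \<open>MM' n k\<close> as \<open>s @ 1 # t\<close>. Since 1 is a valley, the parity of the
  length of \<open>s\<close> decides whether the word is down-up or up-down, and it separates the images of the
  two branches of \<open>rho\<close>: in a down-up word the letter 1 has an odd number of letters before it
  and the letter \<open>n\<close> an even number. In both branches the prefix is reversed; in the second one
  \<open>order_reversal J\<close> maps \<open>n # s2\<close> to \<open>1 # \<tau>\<close>, and as it is an involution of \<open>J\<close>, which is also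
  the set of letters of \<open>1 # \<tau>\<close>, the branch can be undone.
\<close>

section \<open>Alternating words with a prescribed direction of the first step\<close>

text \<open>The flag \<open>d\<close> asks for a descent first. With one flag for both patterns, a
  shift of the starting position, a reversal or a complement becomes a computation on
  \<open>d\<close>. Words with at most one letter satisfy both flags.\<close>

fun zigzag :: "bool \<Rightarrow> nat list \<Rightarrow> bool" where
  "zigzag d (x # y # w) \<longleftrightarrow> (if d then x > y else x < y) \<and> zigzag (\<not> d) (y # w)"
| "zigzag d _ \<longleftrightarrow> True"

lemma zigzag_iff_nth:
  "zigzag d w \<longleftrightarrow>
    (\<forall>i < length w - 1. if even i = d then w ! i > w ! (i + 1) else w ! i < w ! (i + 1))"
proof (induction d w rule: zigzag.induct)
  case (1 d x y w)
  \<comment> \<open>Shifting an index by one flips its parity, which matches the negated flag of the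
    recursive call.\<close>
  have split: "(\<forall>i < length (x # y # w) - 1. P i) \<longleftrightarrow> P 0 \<and> (\<forall>i < length (y # w) - 1. P (Suc i))"
    for P
    by (auto simp: less_Suc_eq_0_disj)
  then show ?case
    unfolding split zigzag.simps(1) 1 by auto
qed auto

lemma down_up_iff_zigzag: "down_up w \<longleftrightarrow> zigzag True w"
  by (simp add: down_up_def zigzag_iff_nth)

lemma up_down_iff_zigzag: "up_down w \<longleftrightarrow> zigzag False w"
  unfolding up_down_def zigzag_iff_nth by auto

lemma alternating_iff_zigzag: "alternating w \<longleftrightarrow> (\<exists>d. zigzag d w)"
  by (simp add: alternating_def down_up_iff_zigzag up_down_iff_zigzag ex_bool_eq)

text \<open>The pivot \<open>a\<close> is kept in both pieces, so every adjacent pair is compared in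
  one of them; the flag at \<open>a\<close> is \<open>d\<close> flipped once per letter of
  \<open>xs\<close>.\<close>

lemma zigzag_append:
  "zigzag d (xs @ a # ys) \<longleftrightarrow> zigzag d (xs @ [a]) \<and> zigzag (d = even (length xs)) (a # ys)"
proof (induction d xs rule: zigzag.induct)
  case ("2_2" d x)
  then show ?case by (cases d) auto
qed auto

lemma zigzag_snoc:
  assumes "xs \<noteq> []"
  shows "zigzag d (xs @ [a]) \<longleftrightarrow>
    zigzag d xs \<and> (if d = odd (length xs) then last xs > a else last xs < a)"
  using assms by (induction d xs rule: zigzag.induct) auto

text \<open>The step into a letter below everything before it is a descent, and the descents end at
  positions of a single parity. This ties \<open>d\<close> to the length of
  \<open>xs\<close>.\<close>

lemma zigzag_valley:
  assumes "xs \<noteq> []" "\<And>x. x \<in> set xs \<Longrightarrow> a < x"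
  shows "zigzag d (xs @ a # ys) \<longleftrightarrow> zigzag d xs \<and> d = odd (length xs) \<and> zigzag False (a # ys)"
proof -
  have "a < last xs" using assms by simp
  then show ?thesis
    by (subst zigzag_append, subst zigzag_snoc[OF assms(1)]) auto
qed

lemma zigzag_peak:
  assumes "xs \<noteq> []" "\<And>x. x \<in> set xs \<Longrightarrow> x < a"
  shows "zigzag d (xs @ a # ys) \<longleftrightarrow> zigzag d xs \<and> d = even (length xs) \<and> zigzag True (a # ys)"
proof -
  have "last xs < a" using assms by simp
  then show ?thesis
    by (subst zigzag_append, subst zigzag_snoc[OF assms(1)]) auto
qed

text \<open>Reading backwards exchanges descents with ascents and starts from the last step. For odd
  length the last step is opposite to the first, so the two effects cancel; for even length the flag
  flips.\<close>

lemma zigzag_rev: "zigzag d (rev xs) \<longleftrightarrow> zigzag (d = odd (length xs)) xs"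
proof (induction "length xs" arbitrary: xs d)
  case (Suc m)
  then obtain x ys where xs: "xs = x # ys" by (cases xs) auto
  show ?case
  proof (cases ys)
    case (Cons y zs)
    have "zigzag d (rev xs) \<longleftrightarrow>
        zigzag d (rev ys) \<and> (if d = odd (length ys) then y > x else y < x)"
      unfolding xs using zigzag_snoc[of "rev ys" d x] Cons by (simp add: last_rev)
    also have "zigzag d (rev ys) \<longleftrightarrow> zigzag (d = odd (length ys)) ys"
      using Suc xs by simp
    finally show ?thesis
      using xs Cons by auto
  qed (simp add: xs)
qed simp

lemma zigzag_map:
  assumes "strict_antimono_on (set xs) f"
  shows "zigzag d (map f xs) \<longleftrightarrow> zigzag (\<not> d) xs"
  using assms
proof (induction d xs rule: zigzag.induct)
  case (1 d x y w)
  \<comment> \<open>On a linear order a strictly antitone map also reflects strict comparisons,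
    whence an equivalence.\<close>
  have "f u < f v \<longleftrightarrow> v < u" if "u \<in> set (x # y # w)" "v \<in> set (x # y # w)" for u v
    using monotone_onD[OF 1(2)] that by (metis less_asym' linorder_neqE_nat)
  moreover have "strict_antimono_on (set (y # w)) f"
    using 1(2) by (rule monotone_on_subset) auto
  ultimately show ?case
    using 1(1) by auto
qed auto

section \<open>Order reversal of a finite set\<close>

text \<open>In the sorted enumeration of \<open>J\<close> the map sends index \<open>i\<close> to
  \<open>card J - 1 - i\<close>, so antitonicity and involution are facts about indices; the image
  follows from closure and involution.\<close>

lemma order_reversal_props:
  assumes "finite J"
  shows order_reversal_strict_antimono: "strict_antimono_on J (order_reversal J)"
    and order_reversal_image: "order_reversal J ` J = J"
    and order_reversal_involution: "x \<in> J \<Longrightarrow> order_reversal J (order_reversal J x) = x"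
proof -
  let ?s = "sorted_list_of_set J"
  have ex: "\<exists>i < card J. x = ?s ! i" if "x \<in> J" for x
    using that assms by (metis in_set_conv_nth length_sorted_list_of_set set_sorted_list_of_set)
  have mem: "?s ! i \<in> J" if "i < card J" for i
    using that assms by (metis length_sorted_list_of_set nth_mem set_sorted_list_of_set)
  have less: "?s ! i < ?s ! j \<longleftrightarrow> i < j" if "i < card J" "j < card J" for i j
    using that sorted_wrt_nth_less[OF strict_sorted_list_of_set[of J]]
    by (metis length_sorted_list_of_set not_less_iff_gr_or_eq)
  note nth = order_reversal_nth[OF assms]
  have closed: "order_reversal J x \<in> J" if "x \<in> J" for x
    using ex[OF that] by (auto simp: nth intro!: mem)
  show inv: "order_reversal J (order_reversal J x) = x" if "x \<in> J" for x
    using ex[OF that] by (auto simp: nth)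
  show "strict_antimono_on J (order_reversal J)"
  proof (rule monotone_onI)
    fix x y assume "x \<in> J" "y \<in> J" "x < y"
    then obtain i j where "i < card J" "j < card J" "x = ?s ! i" "y = ?s ! j" "i < j"
      using ex less by metis
    then show "order_reversal J x > order_reversal J y"
      by (auto simp: nth less)
  qed
  show "order_reversal J ` J = J"
    using closed inv by (auto simp: image_iff) metis
qed

lemma inj_on_order_reversal: "finite J \<Longrightarrow> inj_on (order_reversal J) J"
  by (rule inj_on_inverseI) (rule order_reversal_involution)

text \<open>Some \<open>c\<close> is sent to the minimum \<open>a\<close>; if \<open>c\<close> were
  below the maximum \<open>b\<close>, the image of \<open>b\<close> would lie below
  \<open>a\<close>. The second equation is the involution.\<close>

lemma order_reversal_extremes:
  assumes "finite J" "a \<in> J" "b \<in> J" "\<And>x. x \<in> J \<Longrightarrow> a \<le> x" "\<And>x. x \<in> J \<Longrightarrow> x \<le> b"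
  shows "order_reversal J b = a" "order_reversal J a = b"
proof -
  let ?f = "order_reversal J"
  obtain c where c: "c \<in> J" "?f c = a"
    using assms(2) order_reversal_image[OF assms(1)] by (metis image_iff)
  have "?f b \<in> J" using assms(3) order_reversal_image[OF assms(1)] by blast
  have "c = b"
  proof (rule ccontr)
    assume "c \<noteq> b"
    then have "c < b" using assms(5)[OF c(1)] by simp
    then have "?f b < ?f c"
      using monotone_onD[OF order_reversal_strict_antimono[OF assms(1)]] c(1) assms(3) by blast
    then show False using assms(4)[OF \<open>?f b \<in> J\<close>] c(2) by simp
  qed
  then show "?f b = a" using c by simp
  then show "?f a = b" using order_reversal_involution[OF assms(1,3)] by simp
qed

section \<open>Splitting a word at a letter\<close>

lemma before_letter_append: "a \<notin> set xs \<Longrightarrow> before_letter a (xs @ a # ys) = xs"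
  by (induction xs) (auto simp: before_letter_def)

lemma after_letter_append: "a \<notin> set xs \<Longrightarrow> after_letter a (xs @ a # ys) = ys"
  by (induction xs) (auto simp: after_letter_def)

text \<open>Turns the positional definitions of \<open>occurs_before\<close> and
  \<open>immediately_before\<close> into conditions on the prefix and the suffix.\<close>

lemma nth_eq_pivot_iff:
  assumes "distinct (xs @ a # ys)" "i < length (xs @ a # ys)"
  shows "(xs @ a # ys) ! i = a \<longleftrightarrow> i = length xs"
  using nth_eq_iff_index_eq[OF assms, of "length xs"] by simp

lemma occurs_before_first:
  assumes "distinct (xs @ a # ys)"
  shows "occurs_before a b (xs @ a # ys) \<longleftrightarrow> b \<in> set ys"
proof
  assume "occurs_before a b (xs @ a # ys)"
  then obtain i j where ij: "j < length (xs @ a # ys)" "i < j"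
      "(xs @ a # ys) ! i = a" "(xs @ a # ys) ! j = b"
    unfolding occurs_before_def by blast
  then have "i = length xs" using nth_eq_pivot_iff[OF assms, of i] by simp
  then show "b \<in> set ys" using ij by (auto simp: nth_append nth_Cons')
next
  assume "b \<in> set ys"
  then obtain j where "j < length ys" "ys ! j = b" by (auto simp: in_set_conv_nth)
  then show "occurs_before a b (xs @ a # ys)"
    unfolding occurs_before_def
    by (intro exI[of _ "length xs + Suc j"] conjI exI[of _ "length xs"]) (auto simp: nth_append)
qed

lemma occurs_before_second:
  assumes "distinct (xs @ b # ys)"
  shows "occurs_before a b (xs @ b # ys) \<longleftrightarrow> a \<in> set xs"
proof
  assume "occurs_before a b (xs @ b # ys)"
  then obtain i j where ij: "j < length (xs @ b # ys)" "i < j"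
      "(xs @ b # ys) ! i = a" "(xs @ b # ys) ! j = b"
    unfolding occurs_before_def by blast
  then have "j = length xs" using nth_eq_pivot_iff[OF assms, of j] by simp
  then show "a \<in> set xs" using ij by (auto simp: nth_append)
next
  assume "a \<in> set xs"
  then obtain i where "i < length xs" "xs ! i = a" by (auto simp: in_set_conv_nth)
  then show "occurs_before a b (xs @ b # ys)"
    unfolding occurs_before_def
    by (intro exI[of _ "length xs"] conjI exI[of _ i]) (auto simp: nth_append)
qed

lemma immediately_before_append:
  assumes "distinct (xs @ b # ys)"
  shows "immediately_before a b (xs @ b # ys) \<longleftrightarrow> xs \<noteq> [] \<and> last xs = a"
proof
  assume "immediately_before a b (xs @ b # ys)"
  then obtain i where i: "i < length (xs @ b # ys) - 1"
      "(xs @ b # ys) ! i = a" "(xs @ b # ys) ! (i + 1) = b"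
    unfolding immediately_before_def by blast
  then have "i + 1 = length xs" using nth_eq_pivot_iff[OF assms, of "i + 1"] by simp
  then show "xs \<noteq> [] \<and> last xs = a"
    using i by (cases xs rule: rev_cases) (auto simp: nth_append)
next
  assume "xs \<noteq> [] \<and> last xs = a"
  then obtain zs where "xs = zs @ [a]" by (metis append_butlast_last_id)
  then show "immediately_before a b (xs @ b # ys)"
    unfolding immediately_before_def
    by (intro exI[of _ "length zs"]) (auto simp: nth_append)
qed

section \<open>Membership in \<open>DU\<close> and \<open>MM'\<close> read off the split
  word\<close>

lemma in_permutations_of_set_iff:
  "p \<in> permutations_of_set A \<longleftrightarrow> set p = A \<and> distinct p"
  by (auto simp: permutations_of_set_def)

lemma in_DU_split_one:
  assumes "n \<ge> 2" "set (xs @ 1 # ys) = {1..n}" "distinct (xs @ 1 # ys)"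
  shows "xs @ 1 # ys \<in> DU n k \<longleftrightarrow>
    hd xs = k \<and> odd (length xs) \<and> zigzag True xs \<and> zigzag False (1 # ys)"
proof (cases "xs = []")
  \<comment> \<open>Both sides are false: the right one by parity, the left one because a down-up
    word with at least two letters cannot begin with its least letter.\<close>
  case True
  have "n \<in> set (xs @ 1 # ys)" unfolding assms(2) using assms(1) by simp
  then obtain y zs where ys: "ys = y # zs" using True assms(1) by (cases ys) auto
  then have "y \<in> {1..n}" unfolding assms(2)[symmetric] by simp
  then show ?thesis
    using True ys by (simp add: DU_def down_up_iff_zigzag)
next
  case False
  have "1 < x" if "x \<in> set xs" for x
  proof -
    have "x \<in> {1..n}" using assms(2) that by auto
    moreover have "x \<noteq> 1" using assms(3) that by auto
    ultimately show ?thesis by simp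
  qed
  then show ?thesis
    using False assms by (auto simp: DU_def down_up_iff_zigzag in_permutations_of_set_iff zigzag_valley)
qed

text \<open>Since \<open>k < n\<close>, the letter \<open>n\<close> is not the first one; it is a
  peak entered by an ascent, which forces an even prefix length.\<close>

lemma in_DU_split_top:
  assumes "set (xs @ n # ys) = {1..n}" "distinct (xs @ n # ys)" "k < n"
  shows "xs @ n # ys \<in> DU n k \<longleftrightarrow>
    xs \<noteq> [] \<and> hd xs = k \<and> even (length xs) \<and> zigzag True xs \<and> zigzag True (n # ys)"
proof (cases "xs = []")
  case True
  then show ?thesis using assms(3) by (simp add: DU_def)
next
  case False
  have "x < n" if "x \<in> set xs" for x
  proof -
    have "x \<in> {1..n}" using assms(1) that by auto
    moreover have "x \<noteq> n" using assms(2) that by auto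
    ultimately show ?thesis by simp
  qed
  then show ?thesis
    using False assms by (auto simp: DU_def down_up_iff_zigzag in_permutations_of_set_iff zigzag_peak)
qed

text \<open>Words of \<open>MM' n k\<close> may alternate in either direction; the valley at 1
  resolves this choice through the parity of the prefix.\<close>

lemma in_MM'_split:
  assumes "set (xs @ 1 # ys) = {1..n}" "distinct (xs @ 1 # ys)" "k < n" "n \<ge> 2"
  shows "xs @ 1 # ys \<in> MM' n k \<longleftrightarrow>
    xs \<noteq> [] \<and> last xs = k \<and> n \<in> set ys \<and> zigzag (odd (length xs)) xs \<and> zigzag False (1 # ys)"
proof -
  have "1 < x" if "x \<in> set xs" for x
  proof -
    have "x \<in> {1..n}" using assms(1) that by auto
    moreover have "x \<noteq> 1" using assms(2) that by auto
    ultimately show ?thesis by simp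
  qed
  then have "alternating (xs @ 1 # ys) \<longleftrightarrow>
      zigzag (odd (length xs)) xs \<and> zigzag False (1 # ys)" if "xs \<noteq> []"
    using that by (auto simp: alternating_iff_zigzag zigzag_valley)
  moreover have "xs @ 1 # ys \<in> permutations_of_set {1..n}"
    using assms(1,2) by (simp add: in_permutations_of_set_iff)
  ultimately show ?thesis
    using assms(3,4)
    by (auto simp: MM'_def MM_def immediately_before_append[OF assms(2)]
        occurs_before_first[OF assms(2)] simp del: One_nat_def)
qed

section \<open>The inverse map for \<open>k < n\<close>\<close>

text \<open>Reversal keeps the length of the prefix, so its parity reveals which branch of
  \<open>rho\<close> is to be undone.\<close>

definition rho_inv :: "nat \<Rightarrow> nat list \<Rightarrow> nat list" where
  "rho_inv n p =
    (let s = before_letter 1 p; t = after_letter 1 p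
     in rev s @ (if odd (length s) then 1 # t
                 else n # map (order_reversal (insert 1 (set t))) t))"

lemma rho_inv_append:
  assumes "1 \<notin> set xs"
  shows "rho_inv n (xs @ 1 # ys) =
    rev xs @ (if odd (length xs) then 1 # ys
              else n # map (order_reversal (insert 1 (set ys))) ys)"
  using before_letter_append[OF assms] after_letter_append[OF assms] by (simp add: rho_inv_def)

lemma rho_one_before:
  assumes "k < n" "distinct (xs @ 1 # ys)" "n \<in> set ys"
  shows "rho n k (xs @ 1 # ys) = rev xs @ 1 # ys"
  using assms occurs_before_first[OF assms(2), of n]
  by (simp add: rho_def before_letter_append after_letter_append)

lemma rho_top_before:
  assumes "k < n" "distinct (xs @ n # ys)" "1 \<notin> set xs"
  shows "rho n k (xs @ n # ys) = rev xs @ 1 # map (order_reversal (insert n (set ys))) ys"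
  using assms occurs_before_second[OF assms(2), of 1]
  by (simp add: rho_def before_letter_append after_letter_append)

text \<open>The tail exchange \<open>n # s2 \<leftrightarrow> 1 # \<tau>\<close> of the second branch, in both directions at once.\<close>

lemma reversed_tail:
  fixes a b :: nat and ys :: "nat list"
  defines "J \<equiv> insert b (set ys)"
  defines "zs \<equiv> map (order_reversal J) ys"
  assumes "order_reversal J b = a" "order_reversal J a = b" "a \<in> set ys" "distinct (b # ys)"
  shows "insert a (set zs) = J" "distinct (a # zs)" "b \<in> set zs"
    "map (order_reversal (insert a (set zs))) zs = ys"
    "zigzag d (a # zs) \<longleftrightarrow> zigzag (\<not> d) (b # ys)"
proof -
  let ?f = "order_reversal J"
  have fin: "finite J" by (simp add: J_def)
  have set: "set (b # ys) = J" by (simp add: J_def)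
  \<comment> \<open>As \<open>b\<close> is sent to \<open>a\<close>, pivot and tail together are the
    image of one word under one map.\<close>
  have eq: "a # zs = map ?f (b # ys)" by (simp add: zs_def assms(3))
  show ins: "insert a (set zs) = J"
    using order_reversal_image[OF fin] by (metis eq set list.set_map list.simps(15))
  show "distinct (a # zs)"
    unfolding eq using assms(6) inj_on_order_reversal[OF fin] set by (simp only: distinct_map)
  show "b \<in> set zs" using assms(4,5) by (force simp: zs_def)
  show "map (order_reversal (insert a (set zs))) zs = ys"
    unfolding ins unfolding zs_def map_map
  proof (rule map_idI)
    fix x assume "x \<in> set ys"
    then have "x \<in> J" by (simp add: J_def)
    then show "(?f \<circ> ?f) x = x" using order_reversal_involution[OF fin] by simp
  qed
  show "zigzag d (a # zs) \<longleftrightarrow> zigzag (\<not> d) (b # ys)"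
    unfolding eq using order_reversal_strict_antimono[OF fin] set by (intro zigzag_map) simp
qed

section \<open>The two maps are mutually inverse for \<open>k < n\<close>\<close>

lemma rho_DU:
  assumes "k < n" "n \<ge> 2" "p \<in> DU n k"
  shows "rho n k p \<in> MM' n k \<and> rho_inv n (rho n k p) = p"
proof -
  have p: "set p = {1..n}" "distinct p"
    using assms(3) by (auto simp: DU_def in_permutations_of_set_iff)
  show ?thesis
  proof (cases "occurs_before 1 n p")
    case True
    define xs ys where "xs = before_letter 1 p" and "ys = after_letter 1 p"
    have eq: "p = xs @ 1 # ys"
      unfolding xs_def ys_def using p assms(2) by (intro split_at_letter) simp
    have n: "n \<in> set ys" using True p(2) unfolding eq by (simp add: occurs_before_first)
    have props: "hd xs = k" "odd (length xs)" "zigzag True xs" "zigzag False (1 # ys)"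
      using in_DU_split_one[of n xs ys k] assms p unfolding eq by auto
    have ne: "xs \<noteq> []" using props(2) by auto
    have r: "rho n k p = rev xs @ 1 # ys"
      using rho_one_before[of k n xs ys] assms(1) p(2) n unfolding eq by simp
    \<comment> \<open>Reversal puts the first letter \<open>k\<close> right before 1 and, the prefix
      being odd, preserves its flag.\<close>
    have "rev xs @ 1 # ys \<in> MM' n k"
      using p props n ne assms(1,2) unfolding eq
      by (subst in_MM'_split) (auto simp: zigzag_rev last_rev)
    moreover have "rho_inv n (rev xs @ 1 # ys) = p"
      using p(2) props(2) unfolding eq by (subst rho_inv_append) auto
    ultimately show ?thesis by (simp add: r)
  next
    case False
    define xs ys where "xs = before_letter n p" and "ys = after_letter n p"
    have eq: "p = xs @ n # ys"
      unfolding xs_def ys_def using p assms(2) by (intro split_at_letter) simp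
    have one: "1 \<notin> set xs" using False p(2) unfolding eq by (simp add: occurs_before_second)
    have "1 \<in> set p" using p(1) assms(2) by simp
    then have one': "1 \<in> set ys" using one assms(2) unfolding eq by auto
    define J where "J = insert n (set ys)"
    define zs where "zs = map (order_reversal J) ys"
    have sub: "J \<subseteq> {1..n}" unfolding p(1)[symmetric] eq J_def by auto
    \<comment> \<open>\<open>J\<close> lies in \<open>{1..n}\<close> and contains both endpoints, so
      its reversal exchanges them whatever other letters it omits.\<close>
    have ext: "order_reversal J n = 1" "order_reversal J 1 = n"
      using sub one' by (intro order_reversal_extremes; force simp: J_def)+
    have "distinct (n # ys)" using p(2) unfolding eq by simp
    note tail = reversed_tail[of n ys 1, folded J_def, folded zs_def, OF ext one' this]
    have props: "xs \<noteq> []" "hd xs = k" "even (length xs)" "zigzag True xs" "zigzag True (n # ys)"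
      using in_DU_split_top[of xs n ys k] assms p unfolding eq by auto
    have r: "rho n k p = rev xs @ 1 # zs"
      using rho_top_before[of k n xs ys] assms(1) p(2) one
      unfolding eq zs_def J_def by simp
    have "set (rev xs @ 1 # zs) = set xs \<union> J" using tail(1) by auto
    also have "\<dots> = {1..n}" unfolding p(1)[symmetric] eq J_def by auto
    finally have s: "set (rev xs @ 1 # zs) = {1..n}" .
    have "set xs \<inter> J = {}" using p(2) unfolding eq J_def by auto
    then have d: "distinct (rev xs @ 1 # zs)"
      using tail(1,2) p(2) unfolding eq by auto
    \<comment> \<open>The even prefix changes its flag to \<open>False\<close> under reversal, as
      required before the valley; \<open>tail(5)\<close> turns the peak at \<open>n\<close> into a
      valley at 1, and \<open>tail(3)\<close> places \<open>n\<close> after 1.\<close>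
    have "rev xs @ 1 # zs \<in> MM' n k"
      using in_MM'_split[OF s d assms(1,2)] props tail(3) tail(5)[of False]
      by (simp add: zigzag_rev last_rev)
    moreover have "rho_inv n (rev xs @ 1 # zs) = p"
      using one props(3) tail(4) unfolding eq by (subst rho_inv_append) auto
    ultimately show ?thesis by (simp add: r)
  qed
qed

lemma rho_inv_MM':
  assumes "k < n" "n \<ge> 2" "p \<in> MM' n k"
  shows "rho_inv n p \<in> DU n k \<and> rho n k (rho_inv n p) = p"
proof -
  have p: "set p = {1..n}" "distinct p"
    using assms by (auto simp: MM'_def MM_def in_permutations_of_set_iff)
  define xs ys where "xs = before_letter 1 p" and "ys = after_letter 1 p"
  have eq: "p = xs @ 1 # ys"
    unfolding xs_def ys_def using p assms(2) by (intro split_at_letter) simp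
  have props: "xs \<noteq> []" "last xs = k" "n \<in> set ys" "zigzag (odd (length xs)) xs"
      "zigzag False (1 # ys)"
    using in_MM'_split[of xs ys n k] assms p unfolding eq by auto
  have one: "1 \<notin> set xs" using p(2) unfolding eq by simp
  show ?thesis
  proof (cases "odd (length xs)")
    case True
    have r: "rho_inv n p = rev xs @ 1 # ys"
      unfolding eq using rho_inv_append[OF one] True by simp
    have d: "distinct (rev xs @ 1 # ys)" and s: "set (rev xs @ 1 # ys) = {1..n}"
      using p unfolding eq by auto
    have "rev xs @ 1 # ys \<in> DU n k"
      using in_DU_split_one[OF assms(2) s d] props True by (simp add: zigzag_rev hd_rev)
    \<comment> \<open>The letter \<open>n\<close> is still after 1, so \<open>rho\<close> takes its
      first branch.\<close>
    moreover have "rho n k (rev xs @ 1 # ys) = p"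
      using rho_one_before[OF assms(1) d props(3)] by (simp add: eq)
    ultimately show ?thesis by (simp add: r)
  next
    case False
    define J where "J = insert 1 (set ys)"
    define zs where "zs = map (order_reversal J) ys"
    have sub: "J \<subseteq> {1..n}" unfolding p(1)[symmetric] eq J_def by auto
    have ext: "order_reversal J 1 = n" "order_reversal J n = 1"
      using sub props(3) by (intro order_reversal_extremes; force simp: J_def)+
    have "distinct (1 # ys)" using p(2) unfolding eq by simp
    \<comment> \<open>The same exchange with the roles of 1 and \<open>n\<close> swapped.\<close>
    note tail = reversed_tail[of 1 ys n, folded J_def, folded zs_def, OF ext props(3) this]
    have r: "rho_inv n p = rev xs @ n # zs"
      unfolding eq zs_def J_def using rho_inv_append[OF one] False by simp
    have "set (rev xs @ n # zs) = set xs \<union> J" using tail(1) by auto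
    also have "\<dots> = {1..n}" unfolding p(1)[symmetric] eq J_def by auto
    finally have s: "set (rev xs @ n # zs) = {1..n}" .
    have "set xs \<inter> J = {}" using p(2) unfolding eq J_def by auto
    then have d: "distinct (rev xs @ n # zs)"
      using tail(1,2) p(2) unfolding eq by auto
    have "rev xs @ n # zs \<in> DU n k"
      using in_DU_split_top[OF s d assms(1)] props tail(5)[of True] False
      by (simp add: zigzag_rev hd_rev)
    moreover have "rho n k (rev xs @ n # zs) = p"
      using rho_top_before[OF assms(1) d] one tail(4) by (simp add: eq)
    ultimately show ?thesis by (simp add: r)
  qed
qed

section \<open>The case \<open>k = n\<close>: complementation\<close>

lemma complement_permutation:
  assumes "set p = {1..n}" "distinct p"
  defines "q \<equiv> map (\<lambda>x. n + 1 - x) p"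
  shows "set q = {1..n}" "distinct q" "map (\<lambda>x. n + 1 - x) q = p"
    "zigzag d q \<longleftrightarrow> zigzag (\<not> d) p"
proof -
  \<comment> \<open>Subtraction on \<open>nat\<close> truncates, so the bound on the letters matters
    here.\<close>
  have inv: "n + 1 - (n + 1 - x) = x" if "x \<in> {1..n}" for x
    using that by auto
  show m: "map (\<lambda>x. n + 1 - x) q = p"
    unfolding q_def map_map by (rule map_idI) (use assms(1) inv in auto)
  \<comment> \<open>\<open>p\<close> is itself the image of \<open>q\<close> and has no repeated
    letter, so neither has \<open>q\<close>.\<close>
  show "distinct q"
    using m assms(2) distinct_map by metis
  have "(\<lambda>x. n + 1 - x) ` {1..n} = {1..n}"
  proof
    show "{1..n} \<subseteq> (\<lambda>x. n + 1 - x) ` {1..n}"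
    proof
      fix x assume x: "x \<in> {1..n}"
      then have "n + 1 - x \<in> {1..n}" by auto
      then show "x \<in> (\<lambda>x. n + 1 - x) ` {1..n}" by (rule rev_image_eqI) (rule inv[OF x, symmetric])
    qed
  qed auto
  then show "set q = {1..n}" by (simp only: q_def set_map assms(1))
  show "zigzag d q \<longleftrightarrow> zigzag (\<not> d) p"
    unfolding q_def by (rule zigzag_map) (auto simp: assms(1) intro!: monotone_onI)
qed

lemma in_DU_top: "p \<in> DU n n \<longleftrightarrow> set p = {1..n} \<and> distinct p \<and> zigzag True p \<and> hd p = n"
  by (auto simp: DU_def in_permutations_of_set_iff down_up_iff_zigzag)

text \<open>After an initial 1 the first step, if any, is an ascent, and every other letter comes
  later, including \<open>n\<close> when \<open>n > 1\<close>. For \<open>n = 1\<close> the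
  convention in \<open>MM\<close> applies.\<close>

lemma in_MM'_top:
  assumes "n \<ge> 1"
  shows "p \<in> MM' n n \<longleftrightarrow> set p = {1..n} \<and> distinct p \<and> zigzag False p \<and> hd p = 1"
proof -
  have "alternating p \<and> (n = 1 \<or> occurs_before 1 n p) \<longleftrightarrow> zigzag False p"
    if p: "set p = {1..n}" "distinct p" "hd p = 1"
  proof -
    obtain w where w: "p = 1 # w" using p(1,3) assms by (cases p) auto
    show ?thesis
    proof (cases w)
      case Nil
      have "n \<in> set p" unfolding p(1) using assms by simp
      then have "n = 1" using w Nil by simp
      then show ?thesis using w Nil by (auto simp: alternating_iff_zigzag)
    next
      case (Cons y v)
      have "y \<in> {1..n}" "y \<noteq> 1" using p(1,2) w Cons by auto
      then have "y > 1" "n \<noteq> 1" by auto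
      moreover have "n \<in> set w" using p(1) w assms calculation(2) by (metis atLeastAtMost_iff order_refl set_ConsD)
      moreover have "occurs_before 1 n p \<longleftrightarrow> n \<in> set w"
        using occurs_before_first[of "[]" 1 w n] p(2) w by simp
      ultimately show ?thesis using w Cons by (auto simp: alternating_iff_zigzag)
    qed
  qed
  then show ?thesis by (auto simp: MM'_def MM_def in_permutations_of_set_iff)
qed

text \<open>Complementation is its own inverse; it exchanges the two directions and the first
  letters \<open>n\<close> and 1.\<close>

lemma bij_betw_rho_top:
  assumes "n \<ge> 1"
  shows "bij_betw (rho n n) (DU n n) (MM' n n)"
proof -
  have rho: "rho n n = map (\<lambda>x. n + 1 - x)" by (rule ext) (simp add: rho_def)
  note mem = in_DU_top in_MM'_top[OF assms]
  have hd: "hd (map (\<lambda>x. n + 1 - x) p) = n + 1 - hd p" if "set p = {1..n}" for p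
    using that assms by (intro hd_map) auto
  note compl = complement_permutation[of _ n]
  show ?thesis
    unfolding rho
  proof (rule bij_betw_byWitness[where f' = "map (\<lambda>x. n + 1 - x)"])
    show "map (\<lambda>x. n + 1 - x) ` DU n n \<subseteq> MM' n n"
    proof (rule image_subsetI)
      fix p assume "p \<in> DU n n"
      then have "set p = {1..n}" "distinct p" "zigzag True p" "hd p = n"
        unfolding mem by blast+
      then show "map (\<lambda>x. n + 1 - x) p \<in> MM' n n"
        unfolding mem using compl[of p] hd[of p] by simp
    qed
    show "map (\<lambda>x. n + 1 - x) ` MM' n n \<subseteq> DU n n"
    proof (rule image_subsetI)
      fix p assume "p \<in> MM' n n"
      then have "set p = {1..n}" "distinct p" "zigzag False p" "hd p = 1"
        unfolding mem by blast+
      then show "map (\<lambda>x. n + 1 - x) p \<in> DU n n"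
        unfolding mem using compl[of p] hd[of p] by simp
    qed
  qed (use compl(3) mem in blast)+
qed

theorem theorem8:
  fixes n k :: nat
  assumes "n \<ge> 1" and "k \<in> {1..n}"
  shows "bij_betw (rho n k) (DU n k) (MM' n k)"
proof (cases "k = n")
  case True
  then show ?thesis using bij_betw_rho_top[OF assms(1)] by simp
next
  case False
  \<comment> \<open>From \<open>1 \<le> k < n\<close> the letters 1 and \<open>n\<close> are
    distinct, as the split lemmas require.\<close>
  then have "k < n" "n \<ge> 2" using assms(2) by auto
  then show ?thesis
    using rho_DU rho_inv_MM' by (intro bij_betw_byWitness[where f' = "rho_inv n"]) auto
qed

end
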